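(* Let $\rho$ be a probability density function on $[0,1]$ (with respect to Lebesgue measure) such that $\int_0^1\frac{\rho(u)}{1-u}\,\mathrm{d}u<\infty$. Then the residual allocation model from the measure $\rho(x)\,\mathrm{d}x$ has the same Bernoulli($\tfrac12$) convolution as $\mathrm{GEM}(2)$ if and only if $$x\,\rho(x)=(1-x)\,\rho(1-x)\quad\text{for almost all }x\in[0,1].$$
   Context: Residual allocation: given a Borel probability measure $\mu$ on $[0,1]$ with $\mu(\{0\})<1$, let $(Y_i)_{i\ge1}$ be i.i.d. random variables with law $\mu$ and set $X_1=Y_1$ and $X_i=Y_i\prod_{j=1}^{i-1}(1-Y_j)$ for $i\ge2$. Then almost surely $X_i\ge0$ and $\sum_{i\ge1}X_i=1$; the sequence $(X_i)_{i\ge1}$ is called the residual allocation model from $\mu$. Bernoulli($p$) convolution: let $(\varepsilon_i)_{i\ge1}$ be i.i.d. Bernoulli($p$) random variables (values in $\{0,1\}$, $P(\varepsilon_i=1)=p$), independent of $(X_i)_{i\ge1}$. The Bernoulli($p$) convolution of $(X_i)_{i\ge1}$ is the law of $Z=\sum_{i\ge1}\varepsilon_iX_i$. $\mathrm{GEM}(\theta)$ is the residual allocation model from $\mu=\mathrm{Beta}(1,\theta)$, the probability measure on $[0,1]$ with density $\theta(1-x)^{\theta-1}$; in particular $\mathrm{GEM}(2)$ is the residual allocation model from the density $2(1-x)$. *)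

theory Defs
  imports "HOL-Probability.Probability"
begin

text \<open>Sequences are indexed from 0, so the term \<open>X\<^sub>i\<close> with \<open>i \<ge> 1\<close> of the usual notation is
  the value at index \<open>i - 1\<close>.\<close>

definition residual_fractions :: "(nat \<Rightarrow> real) \<Rightarrow> nat \<Rightarrow> real" where
  "residual_fractions y i = y i * (\<Prod>j<i. 1 - y j)"

text \<open>The law, on the space of real sequences, of the residual allocation model from \<open>\<mu>\<close>. The
  i.i.d. sequence with law \<open>\<mu>\<close> is the coordinate process of the infinite product measure. A
  measure on \<open>[0,1]\<close> is represented as a Borel measure on the real line carried by \<open>{0..1}\<close>.\<close>

definition residual_allocation :: "real measure \<Rightarrow> (nat \<Rightarrow> real) measure" where
  "residual_allocation \<mu> =
     distr (PiM UNIV (\<lambda>_. \<mu>)) (PiM UNIV (\<lambda>_. borel)) residual_fractions"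

text \<open>\<open>\<nu>\<close> is the law of the sequence \<open>X\<close>; independence of \<open>X\<close> and of the i.i.d. Bernoulli
  sequence is encoded by the binary product measure.\<close>

definition bernoulli_convolution :: "real \<Rightarrow> (nat \<Rightarrow> real) measure \<Rightarrow> real measure" where
  "bernoulli_convolution p \<nu> =
     distr (\<nu> \<Otimes>\<^sub>M PiM UNIV (\<lambda>_. measure_pmf (bernoulli_pmf p))) borel
       (\<lambda>(x, e). \<Sum>i. of_bool (e i) * x i)"

definition unit_interval_density :: "(real \<Rightarrow> real) \<Rightarrow> real measure" where
  "unit_interval_density \<rho> = density lborel (\<lambda>x. ennreal (indicator {0..1} x * \<rho> x))"

definition prob_density_unit_interval :: "(real \<Rightarrow> real) \<Rightarrow> bool" where
  "prob_density_unit_interval \<rho> \<longleftrightarrow>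
     set_borel_measurable borel {0..1} \<rho> \<and> (\<forall>x\<in>{0..1}. 0 \<le> \<rho> x) \<and>
     (\<integral>\<^sup>+x\<in>{0..1}. ennreal (\<rho> x) \<partial>lborel) = 1"

definition GEM :: "real \<Rightarrow> (nat \<Rightarrow> real) measure" where
  "GEM \<theta> = residual_allocation (unit_interval_density (\<lambda>x. \<theta> * (1 - x) powr (\<theta> - 1)))"

text \<open>The canonical construction gives the law of \<open>Z\<close> on every probability space.
  Independence of \<open>X\<close> and \<open>E\<close>, which have different types, is stated as factorisation of
  their joint law.\<close>

lemma measurable_residual_fractions:
  assumes "sets \<mu> = sets borel"
  shows "residual_fractions \<in> PiM UNIV (\<lambda>_. \<mu>) \<rightarrow>\<^sub>M PiM UNIV (\<lambda>_. borel)"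
proof -
  have [measurable]: "(\<lambda>y. y i) \<in> borel_measurable (PiM UNIV (\<lambda>_. \<mu>))" for i :: nat
    by (subst measurable_cong_sets[OF refl assms, symmetric]) (rule measurable_component_singleton, simp)
  show ?thesis
    by (rule measurable_PiM_single') (auto simp: residual_fractions_def)
qed

lemma (in prob_space) distr_bernoulli_convolution_residual_allocation:
  fixes Y :: "nat \<Rightarrow> 'a \<Rightarrow> real" and E :: "nat \<Rightarrow> 'a \<Rightarrow> bool"
  defines "X \<equiv> \<lambda>\<omega>. residual_fractions (\<lambda>i. Y i \<omega>)"
  assumes Y: "indep_vars (\<lambda>_. borel) Y UNIV" "\<And>i. distr M borel (Y i) = \<mu>"
    and E: "indep_vars (\<lambda>_. count_space UNIV) E UNIV"
      "\<And>i. distr M (count_space UNIV) (E i) = measure_pmf (bernoulli_pmf p)"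
    and XE: "distr M (PiM UNIV (\<lambda>_. borel) \<Otimes>\<^sub>M PiM UNIV (\<lambda>_. count_space UNIV)) (\<lambda>\<omega>. (X \<omega>, \<lambda>i. E i \<omega>)) =
      distr M (PiM UNIV (\<lambda>_. borel)) X \<Otimes>\<^sub>M distr M (PiM UNIV (\<lambda>_. count_space UNIV)) (\<lambda>\<omega> i. E i \<omega>)"
  shows "distr M borel (\<lambda>\<omega>. \<Sum>i. of_bool (E i \<omega>) * X \<omega> i)
    = bernoulli_convolution p (residual_allocation \<mu>)"
proof -
  let ?S = "PiM UNIV (\<lambda>_. borel) :: (nat \<Rightarrow> real) measure"
  let ?B = "PiM UNIV (\<lambda>_. count_space UNIV) :: (nat \<Rightarrow> bool) measure"
  have Ym: "Y i \<in> borel_measurable M" and Em: "E i \<in> M \<rightarrow>\<^sub>M count_space UNIV" for i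
    using Y(1) E(1) by (auto simp: indep_vars_def)
  have s: "sets \<mu> = sets borel"
    using Y(2)[of 0] by auto
  have Ylaw: "distr M ?S (\<lambda>\<omega> i. Y i \<omega>) = PiM UNIV (\<lambda>_. \<mu>)"
    using Y indep_vars_iff_distr_eq_PiM[where I=UNIV and X=Y and M'="\<lambda>_. borel"] Ym
    by (simp add: restrict_UNIV)
  have Elaw: "distr M ?B (\<lambda>\<omega> i. E i \<omega>) = PiM UNIV (\<lambda>_. measure_pmf (bernoulli_pmf p))"
    using E indep_vars_iff_distr_eq_PiM[where I=UNIV and X=E and M'="\<lambda>_. count_space UNIV"] Em
    by (simp add: restrict_UNIV)
  have Yseq: "(\<lambda>\<omega> i. Y i \<omega>) \<in> M \<rightarrow>\<^sub>M ?S"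
    by (rule measurable_PiM_single') (use Ym in auto)
  have Xlaw: "distr M ?S X = residual_allocation \<mu>"
    unfolding residual_allocation_def Ylaw[symmetric]
    using distr_distr[OF measurable_residual_fractions[of borel] Yseq]
    by (simp add: X_def comp_def)
  have joint: "distr M (?S \<Otimes>\<^sub>M ?B) (\<lambda>\<omega>. (X \<omega>, \<lambda>i. E i \<omega>)) =
      residual_allocation \<mu> \<Otimes>\<^sub>M PiM UNIV (\<lambda>_. measure_pmf (bernoulli_pmf p))"
    using XE unfolding Xlaw Elaw by simp
  have rv: "X \<in> M \<rightarrow>\<^sub>M ?S" "(\<lambda>\<omega> i. E i \<omega>) \<in> M \<rightarrow>\<^sub>M ?B"
    using measurable_compose[OF Yseq measurable_residual_fractions[of borel]]
    by (auto simp: X_def intro!: measurable_PiM_single' Em)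
  have "(\<lambda>(x, e). \<Sum>i. of_bool (e i) * x i :: real) \<in> borel_measurable (?S \<Otimes>\<^sub>M ?B)"
    by measurable
  then show ?thesis
    unfolding bernoulli_convolution_def joint[symmetric] using rv
    by (subst distr_distr) (auto simp: comp_def)
qed

end

theory Submission
  imports Defs
begin

text \<open>
  Let \<open>Z\<close> be distributed as the Bernoulli(\<open>p\<close>) convolution of the residual allocation model from \<open>\<mu>\<close>.
  Splitting off the first stick gives the distributional equation
  \<open>Z = \<epsilon> Y + (1 - Y) Z'\<close>, where \<open>Y\<close> has law \<open>\<mu>\<close>, \<open>\<epsilon>\<close> is Bernoulli(\<open>p\<close>), \<open>Z'\<close> is a copy of \<open>Z\<close>, and
  the three are independent (\<open>perpetuity_step_bernoulli_convolution\<close>). The equation has only one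
  solution on the unit interval: the map \<open>z \<mapsto> \<epsilon> y + (1 - y) z\<close> shrinks distances by \<open>1 - y\<close>, and the
  mean of this factor is below 1 unless \<open>\<mu>\<close> sits at 0 (\<open>perpetuity_fixed_point_unique\<close>). So
  \<open>Z\<close> has a given law on the unit interval if and only if that law solves the equation.

  Now take \<open>p = 1/2\<close>, \<open>\<mu> = \<rho>(x) dx\<close> and test the uniform law. Given \<open>Y = y\<close>, a uniform \<open>Z'\<close> makes the right
  side uniform on \<open>[0, 1 - y]\<close> or on \<open>[y, 1]\<close>, with probability 1/2 each. Hence its density at \<open>x\<close> is
  \<open>(G x + G (1 - x)) / 2\<close>, where \<open>G x\<close> is the integral of \<open>\<rho>(u) / (1 - u)\<close> over \<open>[0, x]\<close>
  (\<open>perpetuity_step_uniform\<close>). The uniform law is a solution exactly when this is 1 almost everywhere.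
  As \<open>G\<close> is continuous, this says that \<open>G x + G (1 - x)\<close> is constant, the value of the constant
  being forced by total mass 1; and \<open>G x + G (1 - x)\<close> is constant exactly when the measure
  \<open>\<rho>(u) / (1 - u) du\<close> is invariant under \<open>u \<mapsto> 1 - u\<close>, that is, \<open>\<rho>(x) / (1 - x) = \<rho>(1 - x) / x\<close>
  almost everywhere. The density \<open>2 (1 - x)\<close> has this symmetry, so the convolution of GEM(2) is
  uniform, and the criterion for uniformity becomes a criterion for equality with it.
\<close>

section \<open>The distributional equation\<close>

text \<open>The fixed points of this map on laws are the solutions of \<open>Z = \<epsilon> Y + (1 - Y) Z'\<close>; solutions of
  such random affine equations are known as perpetuities.\<close>

definition perpetuity_step :: "real \<Rightarrow> real measure \<Rightarrow> real measure \<Rightarrow> real measure" where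
  "perpetuity_step p \<mu> P =
     distr (\<mu> \<Otimes>\<^sub>M (measure_pmf (bernoulli_pmf p) \<Otimes>\<^sub>M P)) borel
       (\<lambda>(y, e, z). of_bool e * y + (1 - y) * z)"

lemma measurable_perpetuity_map:
  assumes [measurable_cong]: "sets \<mu> = sets borel" "sets P = sets borel"
  shows "(\<lambda>(y, e, z). of_bool e * y + (1 - y) * z :: real)
    \<in> borel_measurable (\<mu> \<Otimes>\<^sub>M (measure_pmf (bernoulli_pmf p) \<Otimes>\<^sub>M P))"
  by measurable

lemma nn_integral_perpetuity_step:
  assumes "prob_space \<mu>" and [measurable_cong]: "sets \<mu> = sets borel"
    and "prob_space P" and [measurable_cong]: "sets P = sets borel"
    and f [measurable]: "f \<in> borel_measurable borel"
  shows "(\<integral>\<^sup>+x. f x \<partial>perpetuity_step p \<mu> P) =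
    (\<integral>\<^sup>+y. (\<integral>\<^sup>+e. (\<integral>\<^sup>+z. f (of_bool e * y + (1 - y) * z) \<partial>P) \<partial>measure_pmf (bernoulli_pmf p)) \<partial>\<mu>)"
proof -
  let ?B = "measure_pmf (bernoulli_pmf p)"
  interpret P: prob_space P by fact
  interpret BP: pair_prob_space ?B P ..
  show ?thesis
    unfolding perpetuity_step_def
    by (subst nn_integral_distr)
      (auto simp: measurable_perpetuity_map assms BP.nn_integral_fst[symmetric] P.nn_integral_fst[symmetric]
         split_beta' intro!: nn_integral_cong)
qed

lemma real_distribution_perpetuity_step:
  assumes "prob_space \<mu>" "sets \<mu> = sets borel" "prob_space P" "sets P = sets borel"
  shows "real_distribution (perpetuity_step p \<mu> P)"
proof -
  let ?B = "measure_pmf (bernoulli_pmf p)"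
  interpret P: prob_space P by fact
  interpret mu: prob_space \<mu> by fact
  interpret BP: pair_prob_space ?B P ..
  interpret Q: pair_prob_space \<mu> "?B \<Otimes>\<^sub>M P" ..
  show ?thesis
    unfolding perpetuity_step_def
    by (rule Q.P.real_distribution_distr) (use measurable_perpetuity_map assms in blast)
qed

text \<open>Given \<open>Y = y\<close>, the terms \<open>\<epsilon> y\<close> and \<open>(1 - y) Z\<close> are independent, so their characteristic functions
  multiply. In this form the step acts linearly on \<open>char P\<close> and rescales its argument by \<open>1 - y\<close>,
  which is what makes it a contraction.\<close>

lemma char_perpetuity_step:
  assumes "prob_space \<mu>" and [measurable_cong]: "sets \<mu> = sets borel"
    and "prob_space P" and [measurable_cong]: "sets P = sets borel"
  shows "char (perpetuity_step p \<mu> P) t =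
    (CLINT y|\<mu>. (CLINT e|measure_pmf (bernoulli_pmf p). iexp (t * (of_bool e * y))) * char P (t * (1 - y)))"
proof -
  let ?B = "measure_pmf (bernoulli_pmf p)"
  let ?h = "\<lambda>y e z. of_bool e * y + (1 - y) * z :: real"
  interpret P: prob_space P by fact
  interpret mu: prob_space \<mu> by fact
  interpret BP: pair_prob_space ?B P ..
  interpret Q: pair_prob_space \<mu> "?B \<Otimes>\<^sub>M P" ..
  have "char (perpetuity_step p \<mu> P) t =
      (CLINT w|\<mu> \<Otimes>\<^sub>M (?B \<Otimes>\<^sub>M P). (\<lambda>(y, w). iexp (t * ?h y (fst w) (snd w))) w)"
    unfolding char_def perpetuity_step_def
    by (subst integral_distr) (auto simp: measurable_perpetuity_map assms split_beta')
  also have "\<dots> = (CLINT y|\<mu>. CLINT w|?B \<Otimes>\<^sub>M P. iexp (t * ?h y (fst w) (snd w)))"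
    by (rule Q.integral_fst[symmetric]) (intro Q.P.integrable_const_bound[where B=1], auto)
  also have "\<dots> = (CLINT y|\<mu>. CLINT e|?B. CLINT z|P. iexp (t * ?h y e z))"
  proof (rule Bochner_Integration.integral_cong[OF refl])
    fix y
    show "(CLINT w|?B \<Otimes>\<^sub>M P. iexp (t * ?h y (fst w) (snd w))) = (CLINT e|?B. CLINT z|P. iexp (t * ?h y e z))"
      by (subst BP.integral_fst) (auto simp: split_beta' intro!: BP.P.integrable_const_bound[where B=1])
  qed
  also have "\<dots> = (CLINT y|\<mu>. (CLINT e|?B. iexp (t * (of_bool e * y))) * char P (t * (1 - y)))"
  proof -
    have "iexp (t * ?h y e z) = iexp (t * (of_bool e * y)) * iexp (t * (1 - y) * z)" for y e z
      by (simp add: algebra_simps flip: exp_add)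
    then show ?thesis by (simp add: char_def)
  qed
  finally show ?thesis .
qed

section \<open>Uniqueness of the solution\<close>

lemma cmod_char_minus_1_le:
  assumes "real_distribution P" and supp: "AE x in P. 0 \<le> x \<and> x \<le> 1"
  shows "cmod (char P t - 1) \<le> \<bar>t\<bar>"
proof -
  interpret P: real_distribution P by fact
  have int: "integrable P (\<lambda>x. iexp (t * x))"
    by (intro P.integrable_const_bound[where B=1]) auto
  have "char P t - 1 = (CLINT x|P. iexp (t * x) - 1)"
    unfolding char_def using int by (subst Bochner_Integration.integral_diff) (auto simp: P.prob_space[simplified])
  also have "cmod \<dots> \<le> (\<integral>x. cmod (iexp (t * x) - 1) \<partial>P)"
    by (rule integral_norm_bound)
  also have "\<dots> \<le> \<bar>t\<bar>"
  proof (rule P.integral_le_const)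
    show "integrable P (\<lambda>x. cmod (iexp (t * x) - 1))"
      using int by simp
    show "AE x in P. cmod (iexp (t * x) - 1) \<le> \<bar>t\<bar>"
      using supp
    proof eventually_elim
      case (elim x)
      have "cmod (iexp (t * x) - 1) \<le> \<bar>t * x\<bar>"
        using iexp_approx1[of "t * x" 0] by simp
      also have "\<dots> \<le> \<bar>t\<bar>"
        using elim by (simp add: abs_mult mult_left_le)
      finally show ?case .
    qed
  qed
  finally show ?thesis .
qed

text \<open>By linearity, the difference \<open>\<Delta>\<close> of the characteristic functions of two solutions satisfies
  \<open>\<bar>\<Delta> t\<bar> \<le> E \<bar>\<Delta> (t (1 - Y))\<bar>\<close>. A bound \<open>\<bar>\<Delta> t\<bar> \<le> c \<bar>t\<bar>\<close> therefore improves to \<open>\<bar>\<Delta> t\<bar> \<le> c m \<bar>t\<bar>\<close> with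
  \<open>m = E (1 - Y) < 1\<close>. Laws on the unit interval satisfy the first bound with \<open>c = 2\<close>, so iterating
  gives \<open>\<Delta> = 0\<close>.\<close>

theorem perpetuity_fixed_point_unique:
  assumes "prob_space \<mu>" and [measurable_cong]: "sets \<mu> = sets borel"
    and mu_supp: "AE y in \<mu>. 0 \<le> y \<and> y \<le> 1" and nontrivial: "\<not> (AE y in \<mu>. y = 0)"
    and P: "real_distribution P" "AE x in P. 0 \<le> x \<and> x \<le> 1" "perpetuity_step p \<mu> P = P"
    and Q: "real_distribution Q" "AE x in Q. 0 \<le> x \<and> x \<le> 1" "perpetuity_step p \<mu> Q = Q"
  shows "P = Q"
proof -
  interpret mu: prob_space \<mu> by fact
  interpret P: real_distribution P by fact
  interpret Q: real_distribution Q by fact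
  let ?B = "measure_pmf (bernoulli_pmf p)"
  define m where "m = (\<integral>y. 1 - y \<partial>\<mu>)"
  have inty: "integrable \<mu> (\<lambda>y. y)"
    by (rule mu.integrable_const_bound[where B=1]) (use mu_supp in auto)
  have "0 \<le> m"
    unfolding m_def by (rule integral_nonneg_AE) (use mu_supp in auto)
  moreover have "m < 1"
  proof -
    have "0 \<le> (\<integral>y. y \<partial>\<mu>)"
      by (rule integral_nonneg_AE) (use mu_supp in auto)
    moreover have "(\<integral>y. y \<partial>\<mu>) \<noteq> 0"
      using integral_nonneg_eq_0_iff_AE[OF inty] mu_supp nontrivial by auto
    moreover have "m = 1 - (\<integral>y. y \<partial>\<mu>)"
      unfolding m_def using inty by (subst Bochner_Integration.integral_diff) (auto simp: mu.prob_space)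
    ultimately show ?thesis by simp
  qed
  ultimately have m: "0 \<le> m" "m < 1" .
  define h where "h t y = (CLINT e|?B. iexp (t * (of_bool e * y)))" for t y
  have [measurable]: "h t \<in> borel_measurable borel" for t
    unfolding h_def by measurable
  have h_le: "cmod (h t y) \<le> 1" for t y
  proof -
    have "cmod (h t y) \<le> (\<integral>e. cmod (iexp (t * (of_bool e * y))) \<partial>?B)"
      unfolding h_def by (rule integral_norm_bound)
    then show ?thesis by simp
  qed
  let ?\<Delta> = "\<lambda>t. char P t - char Q t"
  have rep: "?\<Delta> t = (CLINT y|\<mu>. h t y * ?\<Delta> (t * (1 - y)))" for t
  proof -
    have int: "integrable \<mu> (\<lambda>y. h t y * char R (t * (1 - y)))" if "real_distribution R" for R
    proof -
      interpret R: real_distribution R by fact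
      show ?thesis
        by (rule mu.integrable_const_bound[where B=1])
          (auto simp: norm_mult intro!: mult_le_one h_le R.cmod_char_le_1)
    qed
    have "?\<Delta> t = (CLINT y|\<mu>. h t y * char P (t * (1 - y))) - (CLINT y|\<mu>. h t y * char Q (t * (1 - y)))"
      using char_perpetuity_step[of \<mu> P p t] char_perpetuity_step[of \<mu> Q p t] assms
        P.prob_space_axioms Q.prob_space_axioms
      by (simp add: h_def)
    then show ?thesis
      using int[OF P(1)] int[OF Q(1)]
      by (simp add: right_diff_distrib flip: Bochner_Integration.integral_diff)
  qed
  have contract: "cmod (?\<Delta> t) \<le> c * m * \<bar>t\<bar>" if c: "\<And>t. cmod (?\<Delta> t) \<le> c * \<bar>t\<bar>" for c t
  proof -
    have "cmod (?\<Delta> t) \<le> (\<integral>y. cmod (h t y * ?\<Delta> (t * (1 - y))) \<partial>\<mu>)"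
      unfolding rep[of t] by (rule integral_norm_bound)
    also have "\<dots> \<le> (\<integral>y. c * \<bar>t\<bar> * (1 - y) \<partial>\<mu>)"
    proof (rule integral_mono_AE)
      have le: "AE y in \<mu>. cmod (h t y * ?\<Delta> (t * (1 - y))) \<le> c * \<bar>t\<bar> * (1 - y)"
        using mu_supp
      proof eventually_elim
        case (elim y)
        have "cmod (h t y * ?\<Delta> (t * (1 - y))) \<le> cmod (?\<Delta> (t * (1 - y)))"
          by (simp add: norm_mult mult_left_le_one_le h_le)
        also have "\<dots> \<le> c * \<bar>t\<bar> * (1 - y)"
          using c[of "t * (1 - y)"] elim by (simp add: abs_mult mult.assoc)
        finally show ?case .
      qed
      then show "AE y in \<mu>. cmod (h t y * ?\<Delta> (t * (1 - y))) \<le> c * \<bar>t\<bar> * (1 - y)" .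
      show int: "integrable \<mu> (\<lambda>y. c * \<bar>t\<bar> * (1 - y))"
        using inty by simp
      show "integrable \<mu> (\<lambda>y. cmod (h t y * ?\<Delta> (t * (1 - y))))"
        by (rule Bochner_Integration.integrable_bound[OF int]) (use le in auto)
    qed
    also have "\<dots> = c * m * \<bar>t\<bar>"
      by (simp add: m_def mult_ac)
    finally show ?thesis .
  qed
  have bound: "cmod (?\<Delta> t) \<le> (2 * m ^ n) * \<bar>t\<bar>" for n t
  proof (induction n arbitrary: t)
    case 0
    have "cmod (?\<Delta> t) \<le> cmod (char P t - 1) + cmod (char Q t - 1)"
      by (metis add.commute diff_diff_eq2 diff_add_cancel norm_triangle_ineq4)
    then show ?case
      using cmod_char_minus_1_le[OF P(1,2), of t] cmod_char_minus_1_le[OF Q(1,2), of t] by simp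
  next
    case (Suc n)
    show ?case
      using contract[OF Suc.IH, of t] by (simp add: mult_ac)
  qed
  have "char P t = char Q t" for t
  proof -
    have "(\<lambda>n. (2 * m ^ n) * \<bar>t\<bar>) \<longlonglongrightarrow> (2 * 0) * \<bar>t\<bar>"
      using m by (intro tendsto_intros LIMSEQ_power_zero) auto
    then have "cmod (?\<Delta> t) \<le> 0"
      using bound[of t] by (intro LIMSEQ_le_const) auto
    then show ?thesis by simp
  qed
  then show ?thesis
    by (intro Levy_uniqueness P(1) Q(1)) auto
qed

section \<open>The Bernoulli convolution solves the equation\<close>

lemma residual_fractions_case_nat:
  "residual_fractions (case_nat a y) 0 = a"
  "residual_fractions (case_nat a y) (Suc i) = (1 - a) * residual_fractions y i"
  by (simp_all add: residual_fractions_def prod.lessThan_Suc_shift del: prod.lessThan_Suc)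

text \<open>After \<open>n\<close> breaks the piece of the unit stick that is left has length \<open>\<Prod>j<n. 1 - y j\<close>. The
  pieces therefore add up to at most 1, which makes every subseries converge.\<close>

lemma sum_residual_fractions: "(\<Sum>i<n. residual_fractions y i) = 1 - (\<Prod>j<n. 1 - y j)"
  by (induction n) (simp_all add: residual_fractions_def algebra_simps)

lemma bernoulli_residual_series:
  assumes y: "\<And>i. 0 \<le> y i \<and> y i \<le> 1"
  shows "summable (\<lambda>i. of_bool (e i) * residual_fractions y i)" (is "summable ?f")
    and "0 \<le> (\<Sum>i. of_bool (e i) * residual_fractions y i)"
    and "(\<Sum>i. of_bool (e i) * residual_fractions y i) \<le> 1"
proof -
  have nn: "0 \<le> residual_fractions y i" for i
    using y by (auto simp: residual_fractions_def intro!: mult_nonneg_nonneg prod_nonneg)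
  have le: "(\<Sum>i<n. ?f i) \<le> 1" for n
  proof -
    have "(\<Sum>i<n. ?f i) \<le> (\<Sum>i<n. residual_fractions y i)"
      by (intro sum_mono) (simp add: nn)
    also have "\<dots> \<le> 1"
      using y by (simp add: sum_residual_fractions prod_nonneg)
    finally show ?thesis .
  qed
  show s: "summable ?f"
    by (rule summableI_nonneg_bounded[OF _ le]) (simp add: nn)
  show "0 \<le> suminf ?f"
    by (rule suminf_nonneg[OF s]) (simp add: nn)
  show "suminf ?f \<le> 1"
    by (rule suminf_le_const[OF s le])
qed

text \<open>The pathwise form of the distributional equation: the pieces after the first one are the pieces of
  the shifted sequence, scaled by what the first break leaves. Convergence is essential here, because
  \<open>suminf\<close> of a divergent series is an arbitrary value that need not respect this splitting.\<close>

lemma bernoulli_residual_series_case_nat: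
  assumes y: "\<And>i. 0 \<le> y i \<and> y i \<le> 1" and a: "0 \<le> a \<and> a \<le> 1"
  shows "(\<Sum>i. of_bool (case_nat b e i) * residual_fractions (case_nat a y) i) =
    of_bool b * a + (1 - a) * (\<Sum>i. of_bool (e i) * residual_fractions y i)"
proof -
  have "0 \<le> case_nat a y i \<and> case_nat a y i \<le> 1" for i
    using y a by (cases i) auto
  from suminf_split_head[OF bernoulli_residual_series(1)[of "case_nat a y" "case_nat b e", OF this]]
  have "(\<Sum>i. of_bool (case_nat b e i) * residual_fractions (case_nat a y) i) =
      of_bool b * a + (\<Sum>i. (1 - a) * (of_bool (e i) * residual_fractions y i))"
    by (simp add: residual_fractions_case_nat mult_ac)
  also have "\<dots> = of_bool b * a + (1 - a) * (\<Sum>i. of_bool (e i) * residual_fractions y i)"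
    by (subst suminf_mult[OF bernoulli_residual_series(1)[OF y]]) simp
  finally show ?thesis .
qed

lemma nn_integral_PiM_case_nat:
  assumes "prob_space M" and [measurable]: "f \<in> borel_measurable (PiM UNIV (\<lambda>_::nat. M))"
  shows "(\<integral>\<^sup>+x. f x \<partial>PiM UNIV (\<lambda>_. M)) = (\<integral>\<^sup>+a. (\<integral>\<^sup>+x. f (case_nat a x) \<partial>PiM UNIV (\<lambda>_. M)) \<partial>M)"
proof -
  interpret prob_space M by fact
  interpret sequence_space M ..
  have "(\<integral>\<^sup>+x. f x \<partial>S) = (\<integral>\<^sup>+x. f x \<partial>distr (M \<Otimes>\<^sub>M S) S (\<lambda>(s, \<omega>). case_nat s \<omega>))"
    by (simp add: PiM_iter)
  also have "\<dots> = (\<integral>\<^sup>+a. (\<integral>\<^sup>+x. f (case_nat a x) \<partial>S) \<partial>M)"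
    by (subst nn_integral_distr) (auto simp: P.nn_integral_fst[symmetric] split_beta')
  finally show ?thesis .
qed

context
  fixes \<mu> :: "real measure" and p :: real
  assumes prob_mu: "prob_space \<mu>" and sets_mu [measurable_cong]: "sets \<mu> = sets borel"
    and mu_supp: "AE y in \<mu>. 0 \<le> y \<and> y \<le> 1"
begin

lemma borel_measurable_bernoulli_residual_series:
  "(\<lambda>(y, e). \<Sum>i. of_bool (e i) * residual_fractions y i) \<in> borel_measurable
    (PiM UNIV (\<lambda>_. \<mu>) \<Otimes>\<^sub>M PiM UNIV (\<lambda>_. measure_pmf (bernoulli_pmf p)))"
proof -
  have [measurable]: "residual_fractions \<in> PiM UNIV (\<lambda>_. \<mu>) \<rightarrow>\<^sub>M PiM UNIV (\<lambda>_. borel)"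
    by (rule measurable_residual_fractions[OF sets_mu])
  show ?thesis by measurable
qed

lemma bernoulli_convolution_residual_allocation_eq:
  "bernoulli_convolution p (residual_allocation \<mu>) =
    distr (PiM UNIV (\<lambda>_. \<mu>) \<Otimes>\<^sub>M PiM UNIV (\<lambda>_. measure_pmf (bernoulli_pmf p))) borel
      (\<lambda>(y, e). \<Sum>i. of_bool (e i) * residual_fractions y i)"
proof -
  let ?B = "PiM UNIV (\<lambda>_. measure_pmf (bernoulli_pmf p)) :: (nat \<Rightarrow> bool) measure"
  have rf [measurable]: "residual_fractions \<in> PiM UNIV (\<lambda>_. \<mu>) \<rightarrow>\<^sub>M PiM UNIV (\<lambda>_. borel)"
    by (rule measurable_residual_fractions[OF sets_mu])
  interpret B: prob_space ?B
    by (intro prob_space_PiM measure_pmf.prob_space_axioms)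
  have "residual_allocation \<mu> \<Otimes>\<^sub>M ?B = residual_allocation \<mu> \<Otimes>\<^sub>M distr ?B ?B (\<lambda>e. e)"
    by simp
  also have "\<dots> = distr (PiM UNIV (\<lambda>_. \<mu>) \<Otimes>\<^sub>M ?B) (PiM UNIV (\<lambda>_. borel) \<Otimes>\<^sub>M ?B)
      (\<lambda>(y, e). (residual_fractions y, e))"
    unfolding residual_allocation_def
    by (rule pair_measure_distr[OF rf]) (simp_all add: B.sigma_finite_measure_axioms)
  finally have joint: "residual_allocation \<mu> \<Otimes>\<^sub>M ?B = \<dots>" .
  show ?thesis
    unfolding bernoulli_convolution_def joint
    by (subst distr_distr) (auto simp: comp_def split_beta')
qed

lemma real_distribution_bernoulli_convolution:
  "real_distribution (bernoulli_convolution p (residual_allocation \<mu>))"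
proof -
  let ?S = "PiM UNIV (\<lambda>_. \<mu>) :: (nat \<Rightarrow> real) measure"
  let ?B = "PiM UNIV (\<lambda>_. measure_pmf (bernoulli_pmf p)) :: (nat \<Rightarrow> bool) measure"
  interpret S: prob_space ?S by (intro prob_space_PiM prob_mu)
  interpret B: prob_space ?B by (intro prob_space_PiM measure_pmf.prob_space_axioms)
  interpret Q: pair_prob_space ?S ?B ..
  show ?thesis
    unfolding bernoulli_convolution_residual_allocation_eq
    by (rule Q.P.real_distribution_distr) (rule borel_measurable_bernoulli_residual_series)
qed

lemma nn_integral_bernoulli_convolution:
  assumes [measurable]: "f \<in> borel_measurable borel"
  shows "(\<integral>\<^sup>+x. f x \<partial>bernoulli_convolution p (residual_allocation \<mu>)) =
    (\<integral>\<^sup>+y. (\<integral>\<^sup>+e. f (\<Sum>i. of_bool (e i) * residual_fractions y i)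
      \<partial>PiM UNIV (\<lambda>_. measure_pmf (bernoulli_pmf p))) \<partial>PiM UNIV (\<lambda>_. \<mu>))"
proof -
  let ?S = "PiM UNIV (\<lambda>_. \<mu>) :: (nat \<Rightarrow> real) measure"
  let ?B = "PiM UNIV (\<lambda>_. measure_pmf (bernoulli_pmf p)) :: (nat \<Rightarrow> bool) measure"
  interpret B: prob_space ?B by (intro prob_space_PiM measure_pmf.prob_space_axioms)
  note [measurable] = borel_measurable_bernoulli_residual_series
  show ?thesis
    unfolding bernoulli_convolution_residual_allocation_eq
    by (subst nn_integral_distr) (auto simp: B.nn_integral_fst[symmetric] split_beta')
qed

lemma AE_PiM_unit_interval: "AE y in PiM UNIV (\<lambda>_::nat. \<mu>). \<forall>i. 0 \<le> y i \<and> y i \<le> 1"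
  unfolding AE_all_countable
  by (intro allI AE_PiM_component prob_mu) (use mu_supp in auto)

lemma AE_bernoulli_convolution:
  "AE x in bernoulli_convolution p (residual_allocation \<mu>). 0 \<le> x \<and> x \<le> 1"
proof -
  let ?S = "PiM UNIV (\<lambda>_. \<mu>) :: (nat \<Rightarrow> real) measure"
  let ?f = "indicator (- {0..1}) :: real \<Rightarrow> ennreal"
  interpret BC: real_distribution "bernoulli_convolution p (residual_allocation \<mu>)"
    by (rule real_distribution_bernoulli_convolution)
  have I0: "(\<integral>\<^sup>+x. ?f x \<partial>bernoulli_convolution p (residual_allocation \<mu>)) = (\<integral>\<^sup>+y. 0 \<partial>?S)"
  proof (subst nn_integral_bernoulli_convolution, simp, rule nn_integral_cong_AE)
    show "AE y in ?S. (\<integral>\<^sup>+e. ?f (\<Sum>i. of_bool (e i) * residual_fractions y i)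
      \<partial>PiM UNIV (\<lambda>_. measure_pmf (bernoulli_pmf p))) = 0"
      using AE_PiM_unit_interval
      by eventually_elim (use bernoulli_residual_series(2,3) in \<open>simp add: indicator_def\<close>)
  qed
  have "AE x in bernoulli_convolution p (residual_allocation \<mu>). ?f x = 0"
    by (subst nn_integral_0_iff_AE[symmetric]) (simp, simp only: I0, simp)
  then show ?thesis
    by (rule AE_mp) (auto simp: indicator_def split: if_splits)
qed

text \<open>Both i.i.d. sequences are split into their first term and an independent tail with the same law.
  The tails enter only through the series that defines the convolution, which is a copy of \<open>Z\<close>.\<close>

theorem perpetuity_step_bernoulli_convolution:
  "perpetuity_step p \<mu> (bernoulli_convolution p (residual_allocation \<mu>)) =
    bernoulli_convolution p (residual_allocation \<mu>)" (is "perpetuity_step p \<mu> ?Z = ?Z")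
proof -
  let ?S = "PiM UNIV (\<lambda>_. \<mu>) :: (nat \<Rightarrow> real) measure"
  let ?b = "measure_pmf (bernoulli_pmf p)"
  let ?B = "PiM UNIV (\<lambda>_. ?b) :: (nat \<Rightarrow> bool) measure"
  let ?W = "\<lambda>y e. \<Sum>i. of_bool (e i) * residual_fractions y i"
  interpret mu: prob_space \<mu> by (rule prob_mu)
  interpret Z: real_distribution ?Z
    by (rule real_distribution_bernoulli_convolution)
  interpret S: prob_space ?S by (intro prob_space_PiM prob_mu)
  interpret B: prob_space ?B by (intro prob_space_PiM measure_pmf.prob_space_axioms)
  interpret T: real_distribution "perpetuity_step p \<mu> ?Z"
    by (intro real_distribution_perpetuity_step prob_mu sets_mu Z.prob_space_axioms Z.events_eq_borel)
  interpret bS: pair_sigma_finite ?b ?S ..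
  note [measurable] = measurable_residual_fractions[OF sets_mu]
  have nn: "(\<integral>\<^sup>+x. f x \<partial>?Z) = (\<integral>\<^sup>+x. f x \<partial>perpetuity_step p \<mu> ?Z)"
    if f [measurable]: "f \<in> borel_measurable borel" for f
  proof -
    have "(\<integral>\<^sup>+x. f x \<partial>?Z) = (\<integral>\<^sup>+y. (\<integral>\<^sup>+e. f (?W y e) \<partial>?B) \<partial>?S)"
      by (rule nn_integral_bernoulli_convolution[OF f])
    also have "\<dots> = (\<integral>\<^sup>+a. (\<integral>\<^sup>+y. (\<integral>\<^sup>+e. f (?W (case_nat a y) e) \<partial>?B) \<partial>?S) \<partial>\<mu>)"
      by (rule nn_integral_PiM_case_nat[OF prob_mu]) measurable
    also have "\<dots> = (\<integral>\<^sup>+a. (\<integral>\<^sup>+y. (\<integral>\<^sup>+b. (\<integral>\<^sup>+e. f (?W (case_nat a y) (case_nat b e)) \<partial>?B) \<partial>?b) \<partial>?S) \<partial>\<mu>)"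
      by (intro nn_integral_cong nn_integral_PiM_case_nat measure_pmf.prob_space_axioms) measurable
    also have "\<dots> = (\<integral>\<^sup>+a. (\<integral>\<^sup>+y. (\<integral>\<^sup>+b. (\<integral>\<^sup>+e. f (of_bool b * a + (1 - a) * ?W y e) \<partial>?B) \<partial>?b) \<partial>?S) \<partial>\<mu>)"
    proof (rule nn_integral_cong_AE, use mu_supp in eventually_elim, rule nn_integral_cong_AE,
        use AE_PiM_unit_interval in eventually_elim)
      fix a :: real and y :: "nat \<Rightarrow> real" assume "0 \<le> a \<and> a \<le> 1" "\<forall>i. 0 \<le> y i \<and> y i \<le> 1"
      then show "(\<integral>\<^sup>+b. (\<integral>\<^sup>+e. f (?W (case_nat a y) (case_nat b e)) \<partial>?B) \<partial>?b) =
          (\<integral>\<^sup>+b. (\<integral>\<^sup>+e. f (of_bool b * a + (1 - a) * ?W y e) \<partial>?B) \<partial>?b)"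
        using bernoulli_residual_series_case_nat[of y a] by simp
    qed
    also have "\<dots> = (\<integral>\<^sup>+a. (\<integral>\<^sup>+b. (\<integral>\<^sup>+y. (\<integral>\<^sup>+e. f (of_bool b * a + (1 - a) * ?W y e) \<partial>?B) \<partial>?S) \<partial>?b) \<partial>\<mu>)"
      by (intro nn_integral_cong bS.Fubini') measurable
    also have "\<dots> = (\<integral>\<^sup>+a. (\<integral>\<^sup>+b. (\<integral>\<^sup>+z. f (of_bool b * a + (1 - a) * z) \<partial>?Z) \<partial>?b) \<partial>\<mu>)"
      by (intro nn_integral_cong nn_integral_bernoulli_convolution[symmetric]) measurable
    also have "\<dots> = (\<integral>\<^sup>+x. f x \<partial>perpetuity_step p \<mu> ?Z)"
      by (intro nn_integral_perpetuity_step[symmetric] prob_mu sets_mu Z.prob_space_axioms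
          Z.events_eq_borel f)
    finally show ?thesis .
  qed
  show ?thesis
  proof (rule measure_eqI)
    fix A assume "A \<in> sets (perpetuity_step p \<mu> ?Z)"
    then have [measurable]: "A \<in> sets borel" by simp
    show "emeasure (perpetuity_step p \<mu> ?Z) A = emeasure ?Z A"
      using nn[of "indicator A"] by simp
  qed simp
qed

end

section \<open>When the uniform law solves the equation\<close>

text \<open>Reflection turns \<open>{x<..}\<close> into \<open>{..<1 - x}\<close>, which without atoms has mass \<open>cdf N (1 - x)\<close>; the
  mass of \<open>{x<..}\<close> itself is the total mass minus \<open>cdf N x\<close>. The half-lines \<open>{x<..}\<close> determine a
  finite measure.\<close>

lemma measure_eq_reflection_iff_cdf:
  fixes N :: "real measure"
  assumes "finite_borel_measure N" and no_atoms: "\<And>x. measure N {x} = 0"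
  shows "N = distr N borel (\<lambda>x. 1 - x) \<longleftrightarrow> (\<forall>x. cdf N x + cdf N (1 - x) = measure N UNIV)"
proof -
  interpret N: finite_borel_measure N by fact
  note [measurable_cong, simp] = N.M_is_borel
  interpret R: finite_measure "distr N borel (\<lambda>x. 1 - x)"
    by (rule N.finite_measure_distr) simp
  have R: "emeasure (distr N borel (\<lambda>x. 1 - x)) {x<..} = ennreal (cdf N (1 - x))" for x
  proof -
    have "emeasure (distr N borel (\<lambda>x. 1 - x)) {x<..} = emeasure N {..<1 - x}"
      by (subst emeasure_distr) (auto simp: N.borel_UNIV intro!: arg_cong[where f="emeasure N"])
    also have "\<dots> = emeasure N ({..<1 - x} \<union> {1 - x})"
      using no_atoms[of "1 - x"]
      by (subst emeasure_Un_null_set) (auto simp: null_sets_def N.emeasure_eq_measure)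
    also have "{..<1 - x} \<union> {1 - x} = {..1 - x}" by auto
    finally show ?thesis by (simp add: cdf_def N.emeasure_eq_measure)
  qed
  have L: "emeasure N {x<..} = ennreal (measure N UNIV - cdf N x)" for x
  proof -
    have "measure N (UNIV - {..x}) = measure N UNIV - measure N {..x}"
      by (rule N.finite_measure_Diff) auto
    moreover have "UNIV - {..x} = {x<..}" by auto
    ultimately show ?thesis by (simp add: cdf_def N.emeasure_eq_measure)
  qed
  show ?thesis
  proof
    assume "N = distr N borel (\<lambda>x. 1 - x)"
    then have "ennreal (measure N UNIV - cdf N x) = ennreal (cdf N (1 - x))" for x
      using L[of x] R[of x] by simp
    then have "measure N UNIV - cdf N x = cdf N (1 - x)" for x
      using N.cdf_bounded[of x] N.cdf_nonneg[of "1 - x"] N.borel_UNIV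
      by (intro ennreal_inj[THEN iffD1]) auto
    then show "\<forall>x. cdf N x + cdf N (1 - x) = measure N UNIV"
      by (metis add.commute diff_add_cancel)
  next
    assume "\<forall>x. cdf N x + cdf N (1 - x) = measure N UNIV"
    then have eq: "measure N UNIV - cdf N x = cdf N (1 - x)" for x
      by (metis add_diff_cancel_left')
    show "N = distr N borel (\<lambda>x. 1 - x)"
      by (rule measure_eqI_lessThan) (auto simp: R L eq)
  qed
qed

lemma nn_integral_affine_interval:
  fixes f :: "real \<Rightarrow> ennreal"
  assumes [measurable]: "f \<in> borel_measurable borel" and "0 < c"
  shows "ennreal c * (\<integral>\<^sup>+z\<in>{0..1}. f (t + c * z) \<partial>lborel) = (\<integral>\<^sup>+x\<in>{t..t + c}. f x \<partial>lborel)"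
proof -
  have "indicator {t..t + c} (t + c * z) = (indicator {0..1} z :: ennreal)" for z
    using \<open>0 < c\<close> by (auto simp: indicator_def zero_le_mult_iff mult_le_cancel_left1)
  then show ?thesis
    using \<open>0 < c\<close> by (subst nn_integral_real_affine[of "\<lambda>x. f x * indicator {t..t + c} x" c t]) simp_all
qed

lemma density_reflect_lborel:
  fixes f :: "real \<Rightarrow> ennreal"
  assumes [measurable]: "f \<in> borel_measurable borel"
  shows "distr (density lborel f) borel (\<lambda>x. 1 - x) = density lborel (\<lambda>x. f (1 - x))"
proof (rule measure_eqI)
  fix A assume "A \<in> sets (distr (density lborel f) borel (\<lambda>x. 1 - x))"
  then have [measurable]: "A \<in> sets borel" by simp
  have "emeasure (distr (density lborel f) borel (\<lambda>x. 1 - x)) A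
      = (\<integral>\<^sup>+x. f x * indicator A (1 - x) \<partial>lborel)"
    by (subst emeasure_distr, simp, simp, subst emeasure_density)
      (auto intro!: nn_integral_cong measurable_sets_borel[of "\<lambda>x. 1 - x" borel] split: split_indicator)
  also have "\<dots> = (\<integral>\<^sup>+x. f (1 - x) * indicator A x \<partial>lborel)"
    by (subst nn_integral_real_affine[where c="-1" and t=1]) auto
  finally show "emeasure (distr (density lborel f) borel (\<lambda>x. 1 - x)) A =
      emeasure (density lborel (\<lambda>x. f (1 - x))) A"
    by (simp add: emeasure_density)
qed simp

lemma real_distribution_uniform: "real_distribution (unit_interval_density (\<lambda>_. 1))"
  unfolding real_distribution_def real_distribution_axioms_def
  by (auto intro!: prob_spaceI simp: unit_interval_density_def emeasure_density ennreal_indicator)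

lemma nn_integral_uniform:
  assumes [measurable]: "f \<in> borel_measurable borel"
  shows "(\<integral>\<^sup>+z. f z \<partial>unit_interval_density (\<lambda>_. 1)) = (\<integral>\<^sup>+z\<in>{0..1}. f z \<partial>lborel)"
  unfolding unit_interval_density_def
  by (subst nn_integral_density) (auto simp: ennreal_indicator mult.commute)

text \<open>A density on the unit interval, extended by 0, with the integrability condition that makes the
  measure \<open>tilted\<close> below finite. That measure has the density \<open>r u / (1 - u)\<close>: the factor
  \<open>1 / (1 - u)\<close> is the height of the uniform density on an interval of length \<open>1 - u\<close>. Its
  distribution function is the function \<open>G\<close> of the introduction.\<close>

locale residual_density =
  fixes r :: "real \<Rightarrow> real"
  assumes measurable_r [measurable]: "r \<in> borel_measurable borel"
    and nonneg: "\<And>x. 0 \<le> r x" and supp: "\<And>x. x \<notin> {0..1} \<Longrightarrow> r x = 0"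
    and total: "(\<integral>\<^sup>+x. ennreal (r x) \<partial>lborel) = 1"
    and finite_integral: "(\<integral>\<^sup>+x. ennreal (r x / (1 - x)) \<partial>lborel) < \<infinity>"
begin

abbreviation (input) "law \<equiv> density lborel (\<lambda>x. ennreal (r x))"
abbreviation (input) "tilted \<equiv> density lborel (\<lambda>x. ennreal (r x / (1 - x)))"
abbreviation (input) "uniform \<equiv> unit_interval_density (\<lambda>_. 1)"

lemma prob_space_law: "prob_space law"
  using total by (intro prob_spaceI) (simp add: emeasure_density)

lemma AE_law: "AE x in law. 0 \<le> x \<and> x \<le> 1"
  using supp by (subst AE_density) (force intro!: AE_I2)+

lemma law_nontrivial: "\<not> (AE x in law. x = 0)"
proof
  interpret prob_space law by (rule prob_space_law)
  assume "AE x in law. x = 0"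
  moreover have "AE x in law. x \<noteq> 0"
    using AE_lborel_singleton[of "0::real"] by (subst AE_density) auto
  ultimately have "AE x in law. False" by eventually_elim simp
  then show False by simp
qed

lemma finite_borel_measure_tilted: "finite_borel_measure tilted"
  using finite_integral
  by (auto simp: finite_borel_measure_def finite_borel_measure_axioms_def emeasure_density
      intro!: finite_measureI)

lemma tilted_singleton: "measure tilted {x} = 0"
proof -
  have "emeasure tilted {x} = 0"
    using AE_lborel_singleton[of x]
    by (simp add: emeasure_density nn_integral_0_iff_AE)
  then show ?thesis by (simp add: measure_def)
qed

lemma cdf_tilted:
  "x \<le> 0 \<Longrightarrow> cdf tilted x = 0" "1 \<le> x \<Longrightarrow> cdf tilted x = measure tilted UNIV"
proof -
  assume "x \<le> 0"
  have "AE y in lborel. ennreal (r y / (1 - y)) * indicator {..x} y = 0"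
    using AE_lborel_singleton[of "0::real"]
  proof eventually_elim
    case (elim y)
    then show ?case
      using \<open>x \<le> 0\<close> supp[of y] by (auto split: split_indicator)
  qed
  then have "emeasure tilted {..x} = 0"
    by (subst emeasure_density) (auto simp: nn_integral_0_iff_AE simp del: mult_eq_0_iff)
  then show "cdf tilted x = 0" by (simp add: cdf_def measure_def)
next
  assume "1 \<le> x"
  then have "emeasure tilted {..x} = emeasure tilted UNIV"
    using supp by (auto simp: emeasure_density intro!: nn_integral_cong split: split_indicator)
  then show "cdf tilted x = measure tilted UNIV" by (simp add: cdf_def measure_def)
qed

text \<open>Given \<open>Y = y\<close>, the step spreads mass 1/2 evenly over each of \<open>[0, 1 - y]\<close> and \<open>[y, 1]\<close>. A point
  \<open>x\<close> of the unit interval is in the first interval if \<open>y \<le> 1 - x\<close> and in the second if \<open>y \<le> x\<close>.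
  Exchanging the integrals over \<open>x\<close> and \<open>y\<close> thus produces the two values of \<open>cdf tilted\<close>.\<close>

lemma perpetuity_step_uniform:
  "perpetuity_step (1/2) law uniform = unit_interval_density (\<lambda>x. (cdf tilted x + cdf tilted (1 - x)) / 2)"
proof (rule measure_eqI)
  interpret U: real_distribution uniform by (rule real_distribution_uniform)
  interpret law: prob_space law by (rule prob_space_law)
  interpret N: finite_borel_measure tilted by (rule finite_borel_measure_tilted)
  interpret NL: pair_sigma_finite tilted lborel ..
  have [measurable]: "cdf tilted \<in> borel_measurable borel"
    by (intro borel_measurable_mono monoI N.cdf_nondecreasing)
  fix A assume "A \<in> sets (perpetuity_step (1/2) law uniform)"
  then have A [measurable]: "A \<in> sets borel" by (simp add: perpetuity_step_def)
  let ?f = "indicator A :: real \<Rightarrow> ennreal"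
  (* The density at x of the law of the new value restricted to A, given Y = y, times 1 - y. *)
  let ?K = "\<lambda>y x. ennreal (1/2) * (?f x * indicator {0..1} x) *
    (indicator {..1 - x} y + indicator {..x} y)"
  have [measurable]: "(\<lambda>(y, x). ?K y x) \<in> borel_measurable (borel \<Otimes>\<^sub>M borel)"
    by (simp add: indicator_def of_bool_def split_beta')
  have inner: "ennreal (r y) * (\<integral>\<^sup>+e. (\<integral>\<^sup>+z. ?f (of_bool e * y + (1 - y) * z) \<partial>uniform) \<partial>measure_pmf (bernoulli_pmf (1/2)))
      = ennreal (r y / (1 - y)) * (\<integral>\<^sup>+x. ?K y x \<partial>lborel)" (is "_ * ?L = _ * ?R")
    if "y \<noteq> 1" for y
  proof (cases "y \<in> {0..1}")
    case True
    with that have y: "0 \<le> y" "y < 1" by auto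
    have "ennreal (1 - y) * ?L =
        ennreal (1/2) * (ennreal (1 - y) * (\<integral>\<^sup>+z\<in>{0..1}. ?f (0 + (1 - y) * z) \<partial>lborel)) +
        ennreal (1/2) * (ennreal (1 - y) * (\<integral>\<^sup>+z\<in>{0..1}. ?f (y + (1 - y) * z) \<partial>lborel))"
      by (simp add: nn_integral_uniform distrib_left mult_ac add_ac del: ennreal_half)
    also have "\<dots> = ennreal (1/2) * (\<integral>\<^sup>+x\<in>{0..1 - y}. ?f x \<partial>lborel) +
        ennreal (1/2) * (\<integral>\<^sup>+x\<in>{y..1}. ?f x \<partial>lborel)"
      using y by (simp only: nn_integral_affine_interval borel_measurable_indicator A) simp
    also have "\<dots> = (\<integral>\<^sup>+x. ennreal (1/2) * (?f x * indicator {0..1 - y} x) +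
        ennreal (1/2) * (?f x * indicator {y..1} x) \<partial>lborel)"
      by (subst nn_integral_add) (auto simp: nn_integral_cmult)
    also have "\<dots> = ?R"
      using y by (intro nn_integral_cong) (auto split: split_indicator simp: distrib_left)
    finally have "?R = ennreal (1 - y) * ?L" ..
    then have "ennreal (r y / (1 - y)) * ?R = ennreal (r y / (1 - y)) * ennreal (1 - y) * ?L"
      by (simp only: mult.assoc)
    also have "ennreal (r y / (1 - y)) * ennreal (1 - y) = ennreal (r y)"
      using y nonneg[of y] by (subst ennreal_mult[symmetric]) auto
    finally show ?thesis ..
  qed (simp add: supp)
  have "emeasure (perpetuity_step (1/2) law uniform) A = (\<integral>\<^sup>+x. ?f x \<partial>perpetuity_step (1/2) law uniform)"
    by (simp add: perpetuity_step_def)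
  also have "\<dots> = (\<integral>\<^sup>+y. (\<integral>\<^sup>+e. (\<integral>\<^sup>+z. ?f (of_bool e * y + (1 - y) * z) \<partial>uniform)
      \<partial>measure_pmf (bernoulli_pmf (1/2))) \<partial>law)"
    by (rule nn_integral_perpetuity_step[OF prob_space_law _ U.prob_space_axioms]) auto
  also have "\<dots> = (\<integral>\<^sup>+y. ennreal (r y) * (\<integral>\<^sup>+e. (\<integral>\<^sup>+z. ?f (of_bool e * y + (1 - y) * z) \<partial>uniform)
      \<partial>measure_pmf (bernoulli_pmf (1/2))) \<partial>lborel)"
    by (subst nn_integral_density) auto
  also have "\<dots> = (\<integral>\<^sup>+y. ennreal (r y / (1 - y)) * (\<integral>\<^sup>+x. ?K y x \<partial>lborel) \<partial>lborel)"
    by (rule nn_integral_cong_AE, use AE_lborel_singleton[of "1::real"] in eventually_elim) (rule inner)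
  also have "\<dots> = (\<integral>\<^sup>+y. (\<integral>\<^sup>+x. ?K y x \<partial>lborel) \<partial>tilted)"
    by (rule nn_integral_density[symmetric]) measurable
  also have "\<dots> = (\<integral>\<^sup>+x. (\<integral>\<^sup>+y. ?K y x \<partial>tilted) \<partial>lborel)"
    by (rule NL.Fubini'[symmetric]) measurable
  also have "\<dots> = (\<integral>\<^sup>+x. ennreal (indicator {0..1} x * ((cdf tilted x + cdf tilted (1 - x)) / 2)) * ?f x \<partial>lborel)"
  proof (rule nn_integral_cong)
    fix x :: real
    have "(\<integral>\<^sup>+y. ?K y x \<partial>tilted) = ennreal (1/2) * (?f x * indicator {0..1} x) * (emeasure tilted {..1 - x} + emeasure tilted {..x})"
      by (simp add: nn_integral_cmult nn_integral_add del: ennreal_half)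
    also have "emeasure tilted {..1 - x} + emeasure tilted {..x} = ennreal (cdf tilted x + cdf tilted (1 - x))"
      by (simp add: N.emeasure_eq_measure cdf_def ennreal_plus add.commute)
    also have "ennreal (1/2) * (?f x * indicator {0..1} x) * \<dots> =
       ennreal (1/2 * (cdf tilted x + cdf tilted (1 - x))) * (?f x * indicator {0..1} x)"
      using N.cdf_nonneg by (subst ennreal_mult) (auto simp: mult_ac)
    finally show "(\<integral>\<^sup>+y. ?K y x \<partial>tilted) = ennreal (indicator {0..1} x * ((cdf tilted x + cdf tilted (1 - x)) / 2)) * ?f x"
      by (auto split: split_indicator)
  qed
  also have "\<dots> = emeasure (unit_interval_density (\<lambda>x. (cdf tilted x + cdf tilted (1 - x)) / 2)) A"
    unfolding unit_interval_density_def by (subst emeasure_density) auto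
  finally show "emeasure (perpetuity_step (1/2) law uniform) A = \<dots>" .
qed (simp add: perpetuity_step_def unit_interval_density_def)

text \<open>If the uniform law is fixed, the density \<open>(G x + G (1 - x)) / 2\<close> is 1 almost everywhere, and by
  continuity everywhere on the unit interval; at \<open>x = 0\<close> this identifies the constant 2 as the total
  mass of \<open>tilted\<close>. Conversely, a constant density on the unit interval that belongs to a probability
  measure must be 1.\<close>

lemma perpetuity_step_uniform_eq_iff:
  "perpetuity_step (1/2) law uniform = uniform \<longleftrightarrow> tilted = distr tilted borel (\<lambda>x. 1 - x)"
proof -
  interpret U: real_distribution uniform by (rule real_distribution_uniform)
  interpret N: finite_borel_measure tilted by (rule finite_borel_measure_tilted)
  let ?s = "\<lambda>x. cdf tilted x + cdf tilted (1 - x)"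
  have [measurable]: "cdf tilted \<in> borel_measurable borel"
    by (intro borel_measurable_mono monoI N.cdf_nondecreasing)
  have "perpetuity_step (1/2) law uniform = uniform \<longleftrightarrow> (\<forall>x. ?s x = measure tilted UNIV)"
  proof
    assume "perpetuity_step (1/2) law uniform = uniform"
    then have "unit_interval_density (\<lambda>x. ?s x / 2) = uniform"
      by (simp only: perpetuity_step_uniform)
    then have "AE x in lborel. ennreal (indicator {0..1} x * (?s x / 2)) = ennreal (indicator {0..1} x * 1)"
      unfolding unit_interval_density_def by (subst (asm) sigma_finite_measure.density_unique_iff[OF sigma_finite_lborel]) auto
    then have "AE x in lborel. x \<in> {0<..<1} \<longrightarrow> x \<in> {x. ?s x = 2}"
    proof eventually_elim
      case (elim x)
      show ?case
      proof
        assume "x \<in> {0<..<1}"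
        with elim have "ennreal (?s x / 2) = ennreal 1" by simp
        moreover have "0 \<le> ?s x / 2" using N.cdf_nonneg[of x] N.cdf_nonneg[of "1 - x"] by simp
        ultimately have "?s x / 2 = 1" by (subst (asm) ennreal_inj) auto
        then show "x \<in> {x. ?s x = 2}" by simp
      qed
    qed
    then have AE: "AE x \<in> {0<..<1} in lebesgue. x \<in> {x. ?s x = 2}"
      by (rule AE_completion)
    have cont: "continuous_on UNIV ?s"
    proof -
      have "isCont (cdf tilted) x" for x
        by (simp add: N.isCont_cdf tilted_singleton)
      then have cdf: "continuous_on UNIV (cdf tilted)"
        by (simp add: continuous_at_imp_continuous_on)
      have "continuous_on UNIV (\<lambda>x. cdf tilted (1 - x))"
        by (rule continuous_on_compose2[OF cdf]) (auto intro!: continuous_intros)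
      with cdf show ?thesis by (rule continuous_on_add)
    qed
    have open_case: "?s x = 2" if "x \<in> {0<..<1}" for x
      using mem_closed_if_AE_lebesgue_open[OF _ _ AE that] closed_Collect_eq[OF cont continuous_on_const]
      by auto
    have "?s 0 = 2"
    proof (rule continuous_constant_on_closure[where S="{0<..<1}" and f="?s"])
      show "continuous_on (closure {0<..<1}) ?s"
        by (rule continuous_on_subset[OF cont]) simp
      show "(0::real) \<in> closure {0<..<1}"
        by simp
    qed (use open_case in auto)
    then have two: "measure tilted UNIV = 2"
      by (simp add: cdf_tilted)
    show "\<forall>x. ?s x = measure tilted UNIV"
    proof
      fix x :: real
      consider "x \<le> 0" | "1 \<le> x" | "x \<in> {0<..<1}" by force
      then show "?s x = measure tilted UNIV"
        using two open_case by cases (auto simp: cdf_tilted)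
    qed
  next
    assume s: "\<forall>x. ?s x = measure tilted UNIV"
    let ?c = "measure tilted UNIV / 2"
    have step: "perpetuity_step (1/2) law uniform = unit_interval_density (\<lambda>_. ?c)"
      unfolding perpetuity_step_uniform using s by simp
    interpret T: real_distribution "perpetuity_step (1/2) law uniform"
      by (intro real_distribution_perpetuity_step prob_space_law U.prob_space_axioms) auto
    have "1 = emeasure (unit_interval_density (\<lambda>_. ?c)) UNIV"
      using T.emeasure_space_1 unfolding step[symmetric] by simp
    also have "\<dots> = (\<integral>\<^sup>+x. ennreal (indicator {0..1::real} x * ?c) * indicator UNIV x \<partial>lborel)"
      unfolding unit_interval_density_def by (rule emeasure_density) simp_all
    also have "\<dots> = (\<integral>\<^sup>+x. ennreal ?c * indicator {0..1::real} x \<partial>lborel)"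
      by (rule nn_integral_cong) (simp split: split_indicator)
    also have "\<dots> = ennreal ?c"
      by (subst nn_integral_cmult_indicator) auto
    finally have "?c = 1" by (metis ennreal_eq_1)
    then show "perpetuity_step (1/2) law uniform = uniform"
      unfolding step by simp
  qed
  also have "\<dots> \<longleftrightarrow> tilted = distr tilted borel (\<lambda>x. 1 - x)"
    by (rule measure_eq_reflection_iff_cdf[symmetric, OF finite_borel_measure_tilted tilted_singleton])
  finally show ?thesis .
qed

lemma tilted_eq_reflection_iff:
  "tilted = distr tilted borel (\<lambda>x. 1 - x) \<longleftrightarrow> (AE x in lborel. x * r x = (1 - x) * r (1 - x))"
proof -
  have "tilted = distr tilted borel (\<lambda>x. 1 - x) \<longleftrightarrow>
      (AE x in lborel. ennreal (r x / (1 - x)) = ennreal (r (1 - x) / x))"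
    by (subst density_reflect_lborel) (auto simp: sigma_finite_measure.density_unique_iff[OF sigma_finite_lborel])
  also have "\<dots> \<longleftrightarrow> (AE x in lborel. x * r x = (1 - x) * r (1 - x))"
  proof (rule eventually_cong[OF eventually_conj[OF AE_lborel_singleton[of 0] AE_lborel_singleton[of 1]]])
    fix x :: real assume x: "x \<noteq> 0 \<and> x \<noteq> 1"
    show "ennreal (r x / (1 - x)) = ennreal (r (1 - x) / x) \<longleftrightarrow> x * r x = (1 - x) * r (1 - x)"
    proof (cases "x \<in> {0..1}")
      case True
      then have "ennreal (r x / (1 - x)) = ennreal (r (1 - x) / x) \<longleftrightarrow> r x / (1 - x) = r (1 - x) / x"
        using nonneg[of x] nonneg[of "1 - x"] by (subst ennreal_inj) auto
      also have "\<dots> \<longleftrightarrow> x * r x = (1 - x) * r (1 - x)"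
        using x by (auto simp: field_simps)
      finally show ?thesis .
    qed (auto simp: supp)
  qed
  finally show ?thesis .
qed

theorem bernoulli_convolution_uniform_iff:
  "bernoulli_convolution (1/2) (residual_allocation law) = uniform \<longleftrightarrow>
    (AE x in lborel. x * r x = (1 - x) * r (1 - x))"
proof -
  let ?Z = "bernoulli_convolution (1/2) (residual_allocation law)"
  have sets: "sets law = sets borel" by simp
  have "?Z = uniform \<longleftrightarrow> perpetuity_step (1/2) law uniform = uniform"
  proof
    assume "?Z = uniform"
    with perpetuity_step_bernoulli_convolution[OF prob_space_law sets AE_law, of "1/2"]
    show "perpetuity_step (1/2) law uniform = uniform" by simp
  next
    assume fixed: "perpetuity_step (1/2) law uniform = uniform"
    have AE_U: "AE x in uniform. 0 \<le> x \<and> x \<le> 1"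
      unfolding unit_interval_density_def by (subst AE_density) (auto intro!: AE_I2 split: split_indicator_asm)
    show "?Z = uniform"
      by (rule perpetuity_fixed_point_unique[OF prob_space_law sets AE_law law_nontrivial
          real_distribution_bernoulli_convolution[OF prob_space_law sets AE_law]
          AE_bernoulli_convolution[OF prob_space_law sets AE_law]
          perpetuity_step_bernoulli_convolution[OF prob_space_law sets AE_law]
          real_distribution_uniform AE_U fixed])
  qed
  then show ?thesis
    by (simp only: perpetuity_step_uniform_eq_iff tilted_eq_reflection_iff)
qed

end

text \<open>The values of \<open>\<rho>\<close> outside the unit interval affect neither side, so \<open>\<rho>\<close> may be replaced by
  its truncation.\<close>

theorem bernoulli_convolution_eq_uniform_iff:
  fixes \<rho> :: "real \<Rightarrow> real"
  assumes \<rho>: "prob_density_unit_interval \<rho>"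
    and fin: "(\<integral>\<^sup>+u\<in>{0..1}. ennreal (\<rho> u / (1 - u)) \<partial>lborel) < \<infinity>"
  shows "bernoulli_convolution (1/2) (residual_allocation (unit_interval_density \<rho>))
           = unit_interval_density (\<lambda>_. 1)
         \<longleftrightarrow> (AE x in lborel. x \<in> {0..1} \<longrightarrow> x * \<rho> x = (1 - x) * \<rho> (1 - x))"
proof -
  let ?r = "\<lambda>x. indicator {0..1} x * \<rho> x"
  interpret residual_density ?r
  proof
    show "?r \<in> borel_measurable borel"
      using \<rho> by (simp add: prob_density_unit_interval_def set_borel_measurable_def)
    show "0 \<le> ?r x" for x
      using \<rho> by (auto simp: prob_density_unit_interval_def split: split_indicator)
    have "(\<integral>\<^sup>+x. ennreal (?r x) \<partial>lborel) = (\<integral>\<^sup>+x\<in>{0..1}. ennreal (\<rho> x) \<partial>lborel)"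
      by (intro nn_integral_cong) (auto split: split_indicator)
    with \<rho> show "(\<integral>\<^sup>+x. ennreal (?r x) \<partial>lborel) = 1"
      by (simp add: prob_density_unit_interval_def)
    have "(\<integral>\<^sup>+x. ennreal (?r x / (1 - x)) \<partial>lborel) = (\<integral>\<^sup>+u\<in>{0..1}. ennreal (\<rho> u / (1 - u)) \<partial>lborel)"
      by (intro nn_integral_cong) (auto split: split_indicator)
    with fin show "(\<integral>\<^sup>+x. ennreal (?r x / (1 - x)) \<partial>lborel) < \<infinity>"
      by simp
  qed auto
  have "(AE x in lborel. x * ?r x = (1 - x) * ?r (1 - x)) \<longleftrightarrow>
      (AE x in lborel. x \<in> {0..1} \<longrightarrow> x * \<rho> x = (1 - x) * \<rho> (1 - x))"
    by (intro arg_cong[where f="\<lambda>P. AE x in lborel. P x"] ext) (auto simp: indicator_def)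
  with bernoulli_convolution_uniform_iff show ?thesis
    by (simp add: unit_interval_density_def)
qed

text \<open>For \<open>\<rho> x = 2 (1 - x)\<close> both sides of the symmetry condition are \<open>2 x (1 - x)\<close>, and
  \<open>\<rho> u / (1 - u)\<close> is the constant 2.\<close>

lemma bernoulli_convolution_GEM_2:
  "bernoulli_convolution (1/2) (GEM 2) = unit_interval_density (\<lambda>_. 1)"
proof -
  let ?\<rho> = "\<lambda>x::real. 2 * (1 - x) powr (2 - 1)"
  have \<rho>: "?\<rho> x = 2 * (1 - x)" if "x \<in> {0..1}" for x
    using that by simp
  have "(\<integral>\<^sup>+x\<in>{0..1}. ennreal (?\<rho> x) \<partial>lborel) = (\<integral>\<^sup>+x. ennreal (2 * (1 - x)) * indicator {0..1} x \<partial>lborel)"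
    by (intro nn_integral_cong) (auto simp: \<rho> split: split_indicator)
  also have "\<dots> = ennreal ((2 * 1 - 1\<^sup>2) - (2 * 0 - 0\<^sup>2))"
    by (rule nn_integral_FTC_Icc[where F="\<lambda>x. 2 * x - x\<^sup>2"]) (auto intro!: derivative_eq_intros)
  finally have "prob_density_unit_interval ?\<rho>"
    by (auto simp: prob_density_unit_interval_def set_borel_measurable_def)
  moreover have "(\<integral>\<^sup>+u\<in>{0..1}. ennreal (?\<rho> u / (1 - u)) \<partial>lborel) < \<infinity>"
  proof -
    have "(\<integral>\<^sup>+u\<in>{0..1}. ennreal (?\<rho> u / (1 - u)) \<partial>lborel) \<le> (\<integral>\<^sup>+u. 2 * indicator {0..1::real} u \<partial>lborel)"
    proof (intro nn_integral_mono)
      fix u :: real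
      show "ennreal (?\<rho> u / (1 - u)) * indicator {0..1} u \<le> 2 * indicator {0..1} u"
      proof (cases "u \<in> {0..1} \<and> u \<noteq> 1")
        case True
        then have "?\<rho> u / (1 - u) = 2"
          by (simp add: \<rho> divide_eq_eq)
        then show ?thesis by simp
      qed (auto split: split_indicator)
    qed
    also have "\<dots> = 2"
      by (subst nn_integral_cmult_indicator) auto
    finally show ?thesis
      by (rule order.strict_trans1) simp
  qed
  moreover have "AE x in lborel. x \<in> {0..1} \<longrightarrow> x * ?\<rho> x = (1 - x) * ?\<rho> (1 - x)"
    by (intro AE_I2) auto
  ultimately show ?thesis
    unfolding GEM_def by (subst bernoulli_convolution_eq_uniform_iff)
qed

theorem proposition3p4:
  fixes \<rho> :: "real \<Rightarrow> real"
  assumes "prob_density_unit_interval \<rho>"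
    and "(\<integral>\<^sup>+u\<in>{0..1}. ennreal (\<rho> u / (1 - u)) \<partial>lborel) < \<infinity>"
  shows "bernoulli_convolution (1/2) (residual_allocation (unit_interval_density \<rho>))
           = bernoulli_convolution (1/2) (GEM 2)
         \<longleftrightarrow> (AE x in lborel. x \<in> {0..1} \<longrightarrow> x * \<rho> x = (1 - x) * \<rho> (1 - x))"
  unfolding bernoulli_convolution_GEM_2 by (rule bernoulli_convolution_eq_uniform_iff[OF assms])

end
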